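(* Let $(\mathcal{A},\mu_A,\alpha)$ and $(\mathcal{B},\mu_B,\beta)$ be multiplicative Hom-associative algebras over $\mathbb{K}$, $\phi:\mathcal{A}\to\mathcal{B}$ a Hom-associative algebra morphism, and $\Theta_t=(\mu_{A,t},\mu_{B,t},\phi_t)$ a deformation of $\phi$. Then its linear coefficient $\theta_1=(\mu_{A,1},\mu_{B,1},\phi_1)$, called the infinitesimal of the deformation $\Theta_t$ of $\phi$, is a $2$-cocycle in $C^2_{Hom}(\phi,\phi)$.
   Context: $\mathbb{K}$ is an algebraically closed field of characteristic $0$. A Hom-associative algebra $(\mathcal{A},\mu,\alpha)$ is a vector space with a bilinear map $\mu$ and a linear map $\alpha$ such that $\mu(\alpha(x),\mu(y,z))=\mu(\mu(x,y),\alpha(z))$; it is multiplicative if $\alpha\circ\mu=\mu\circ(\alpha\otimes\alpha)$. A morphism $\phi:\mathcal{A}\to\mathcal{B}$ is a linear map with $\mu_B\circ(\phi\otimes\phi)=\phi\circ\mu_A$ and $\phi\circ\alpha=\beta\circ\phi$. Deformations: a (one-parameter formal) deformation of $(\mathcal{A},\mu_A,\alpha)$ is a $\mathbb{K}[[t]]$-bilinear map $\mu_{A,t}=\sum_{n\ge0}\mu_{A,n}t^n$ on $\mathcal{A}[[t]]$, with $\mu_{A,n}:\mathcal{A}\times\mathcal{A}\to\mathcal{A}$ bilinear and $\mu_{A,0}=\mu_A$, such that $(\mathcal{A}[[t]],\mu_{A,t},\alpha)$ is a Hom-associative $\mathbb{K}[[t]]$-algebra, i.e. $\mu_{A,t}\circ(\mu_{A,t}\otimes\alpha)=\mu_{A,t}\circ(\alpha\otimes\mu_{A,t})$;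 similarly for $\mathcal{B}$ (with $\beta$). A deformation of $\phi$ is a triple $\Theta_t=(\mu_{A,t},\mu_{B,t},\phi_t)$ where $\mu_{A,t},\mu_{B,t}$ are deformations of $\mathcal{A},\mathcal{B}$ and $\phi_t=\sum_{n\ge0}\phi_nt^n:\mathcal{A}[[t]]\to\mathcal{B}[[t]]$ is a Hom-associative algebra morphism with each $\phi_n:\mathcal{A}\to\mathcal{B}$ linear and $\phi_0=\phi$. Cohomology: for $n\ge1$, $C^n_{\alpha,\beta}(\mathcal{A},\mathcal{B})$ is the space of $n$-linear maps $f:\mathcal{A}^{\times n}\to\mathcal{B}$ with $\beta(f(u_1,\dots,u_n))=f(\alpha(u_1),\dots,\alpha(u_n))$, with $$\delta^n_{Hom}\varphi(x_0,\dots,x_n)=\mu_B(\phi(\alpha^{n-1}(x_0)),\varphi(x_1,\dots,x_n))+\sum_{k=1}^n(-1)^k\varphi(\alpha(x_0),\dots,\alpha(x_{k-2}),\mu_A(x_{k-1},x_k),\alpha(x_{k+1}),\dots,\alpha(x_n))+(-1)^{n+1}\mu_B(\varphi(x_0,\dots,x_{n-1}),\phi(\alpha^{n-1}(x_n))).$$ $C^n_{Hom}(\mathcal{A},\mathcal{A})$ and $C^n_{Hom}(\mathcal{B},\mathcal{B})$ with their $\delta^n_{Hom}$ are the cases where $\phi$ is the identity of $\mathcal{A}$, respectively of $\mathcal{B}$. For $n\ge2$, $C^n_{Hom}(\phi,\phi)=C^n_{Hom}(\mathcal{A},\mathcal{A})\times C^n_{Hom}(\mathcal{B},\mathcal{B})\times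 C^{n-1}_{\alpha,\beta}(\mathcal{A},\mathcal{B})$ and $\delta^n(\varphi_1,\varphi_2,\varphi_3)=(\delta^n_{Hom}\varphi_1,\delta^n_{Hom}\varphi_2,\phi\circ\varphi_1-\varphi_2\circ\phi^{\otimes n}-\delta^{n-1}_{Hom}\varphi_3)$. A $2$-cocycle in $C^2_{Hom}(\phi,\phi)$ is an element annihilated by $\delta^2$.
   Formalization: The infinitesimal is annihilated by δ² for every deformation, but its membership in C²_Hom(φ,φ) is proved only when the deformed algebras A[[t]] and B[[t]] are multiplicative; without this it can fail, e.g. A=K, μ=0, α=2·id, μ_t=xy·t. *)

theory Defs
  imports "HOL-Computational_Algebra.Computational_Algebra"
begin

record ('k, 'a) hom_alg =
  scl :: "'k \<Rightarrow> 'a \<Rightarrow> 'a"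
  mul :: "'a \<Rightarrow> 'a \<Rightarrow> 'a"
  twist :: "'a \<Rightarrow> 'a"

definition bilinear_op ::
  "('k::comm_ring_1 \<Rightarrow> 'a::ab_group_add \<Rightarrow> 'a) \<Rightarrow> ('a \<Rightarrow> 'a \<Rightarrow> 'a) \<Rightarrow> bool" where
  "bilinear_op s m \<longleftrightarrow> (\<forall>x. module_hom s s (m x)) \<and> (\<forall>y. module_hom s s (\<lambda>x. m x y))"

text \<open>The underlying module is the whole type; over a field, \<^const>\<open>module\<close> is the same as
  \<^const>\<open>vector_space\<close>. The definition is needed over a field and over its ring of power series.\<close>

definition hom_assoc_alg :: "('k::comm_ring_1, 'a::ab_group_add) hom_alg \<Rightarrow> bool" where
  "hom_assoc_alg A \<longleftrightarrow>
     module (scl A) \<and> bilinear_op (scl A) (mul A) \<and> module_hom (scl A) (scl A) (twist A) \<and>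
     (\<forall>x y z. mul A (twist A x) (mul A y z) = mul A (mul A x y) (twist A z))"

definition multiplicative :: "('k, 'a) hom_alg \<Rightarrow> bool" where
  "multiplicative A \<longleftrightarrow> (\<forall>x y. twist A (mul A x y) = mul A (twist A x) (twist A y))"

definition hom_alg_morphism ::
  "('k::comm_ring_1, 'a::ab_group_add) hom_alg \<Rightarrow> ('k, 'b::ab_group_add) hom_alg \<Rightarrow>
   ('a \<Rightarrow> 'b) \<Rightarrow> bool" where
  "hom_alg_morphism A B \<phi> \<longleftrightarrow>
     module_hom (scl A) (scl B) \<phi> \<and>
     (\<forall>x y. mul B (\<phi> x) (\<phi> y) = \<phi> (mul A x y)) \<and>
     (\<forall>x. \<phi> (twist A x) = twist B (\<phi> x))"


section \<open>Formal deformations\<close>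

text \<open>\<open>\<A>[[t]]\<close> is the type \<^typ>\<open>'a fps\<close>, of which only the additive structure is used;
  \<open>\<K>[[t]]\<close> is \<^typ>\<open>'k fps\<close>, acting by the Cauchy product.\<close>

definition fps_scl :: "('k \<Rightarrow> 'a \<Rightarrow> 'a) \<Rightarrow> 'k fps \<Rightarrow> 'a::ab_group_add fps \<Rightarrow> 'a fps" where
  "fps_scl s c x = Abs_fps (\<lambda>n. \<Sum>i\<le>n. s (fps_nth c i) (fps_nth x (n - i)))"

definition fps_bilin ::
  "(nat \<Rightarrow> 'a \<Rightarrow> 'a \<Rightarrow> 'a) \<Rightarrow> 'a::ab_group_add fps \<Rightarrow> 'a fps \<Rightarrow> 'a fps" where
  "fps_bilin m x y =
     Abs_fps (\<lambda>n. \<Sum>i\<le>n. \<Sum>j\<le>n - i. m i (fps_nth x j) (fps_nth y (n - i - j)))"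

definition fps_lin :: "(nat \<Rightarrow> 'a \<Rightarrow> 'b) \<Rightarrow> 'a fps \<Rightarrow> 'b::ab_group_add fps" where
  "fps_lin f x = Abs_fps (\<lambda>n. \<Sum>i\<le>n. f i (fps_nth x (n - i)))"

text \<open>\<open>(\<A>[[t]], \<Sum>n. \<mu>\<^sub>n t^n, \<alpha>)\<close> with \<open>\<alpha>\<close> extended coefficientwise.\<close>

definition series_alg ::
  "('k, 'a::ab_group_add) hom_alg \<Rightarrow> (nat \<Rightarrow> 'a \<Rightarrow> 'a \<Rightarrow> 'a) \<Rightarrow> ('k fps, 'a fps) hom_alg" where
  "series_alg A m =
     \<lparr>scl = fps_scl (scl A), mul = fps_bilin m,
      twist = (\<lambda>x. Abs_fps (\<lambda>n. twist A (fps_nth x n)))\<rparr>"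

definition deformation ::
  "('k::comm_ring_1, 'a::ab_group_add) hom_alg \<Rightarrow> (nat \<Rightarrow> 'a \<Rightarrow> 'a \<Rightarrow> 'a) \<Rightarrow> bool" where
  "deformation A m \<longleftrightarrow>
     (\<forall>n. bilinear_op (scl A) (m n)) \<and> m 0 = mul A \<and> hom_assoc_alg (series_alg A m)"

definition morphism_deformation ::
  "('k::comm_ring_1, 'a::ab_group_add) hom_alg \<Rightarrow> ('k, 'b::ab_group_add) hom_alg \<Rightarrow>
   ('a \<Rightarrow> 'b) \<Rightarrow>
   (nat \<Rightarrow> 'a \<Rightarrow> 'a \<Rightarrow> 'a) \<Rightarrow> (nat \<Rightarrow> 'b \<Rightarrow> 'b \<Rightarrow> 'b) \<Rightarrow> (nat \<Rightarrow> 'a \<Rightarrow> 'b) \<Rightarrow> bool" where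
  "morphism_deformation A B \<phi> mA mB p \<longleftrightarrow>
     deformation A mA \<and> deformation B mB \<and>
     (\<forall>n. module_hom (scl A) (scl B) (p n)) \<and> p 0 = \<phi> \<and>
     hom_alg_morphism (series_alg A mA) (series_alg B mB) (fps_lin p)"


section \<open>Cohomology\<close>

text \<open>An \<open>n\<close>-cochain is a function of the list of its arguments; only its values on lists of
  length \<open>n\<close> are meaningful, so every condition on it is restricted to such lists.\<close>

type_synonym ('a, 'b) cochain = "'a list \<Rightarrow> 'b"

definition zero_cochain :: "nat \<Rightarrow> ('a, 'b::ab_group_add) cochain \<Rightarrow> bool" where
  "zero_cochain n f \<longleftrightarrow> (\<forall>xs. length xs = n \<longrightarrow> f xs = 0)"

definition cochains ::
  "nat \<Rightarrow> ('k::comm_ring_1, 'a::ab_group_add) hom_alg \<Rightarrow> ('k, 'b::ab_group_add) hom_alg \<Rightarrow>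
   ('a, 'b) cochain set" where
  "cochains n A B = {f.
     (\<forall>xs i. length xs = n \<and> i < n \<longrightarrow> module_hom (scl A) (scl B) (\<lambda>v. f (xs[i := v]))) \<and>
     (\<forall>xs. length xs = n \<longrightarrow> twist B (f xs) = f (map (twist A) xs))}"

text \<open>The differential from \<open>n\<close>-cochains to \<open>(n+1)\<close>-cochains, for \<open>n \<ge> 1\<close>;
  the argument list is \<open>[x\<^sub>0, \<dots>, x\<^sub>n]\<close>.\<close>

definition hom_delta ::
  "('k::comm_ring_1, 'a::ab_group_add) hom_alg \<Rightarrow> ('k, 'b::ab_group_add) hom_alg \<Rightarrow>
   ('a \<Rightarrow> 'b) \<Rightarrow> nat \<Rightarrow> ('a, 'b) cochain \<Rightarrow> ('a, 'b) cochain" where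
  "hom_delta A B \<phi> n f xs =
     mul B (\<phi> ((twist A ^^ (n - 1)) (xs ! 0))) (f (drop 1 xs)) +
     (\<Sum>k = 1..n. scl B ((-1) ^ k)
        (f (map (twist A) (take (k - 1) xs) @ [mul A (xs ! (k - 1)) (xs ! k)] @
            map (twist A) (drop (k + 1) xs)))) +
     scl B ((-1) ^ (n + 1)) (mul B (f (take n xs)) (\<phi> ((twist A ^^ (n - 1)) (xs ! n))))"

type_synonym ('a, 'b) mor_cochain =
  "('a, 'a) cochain \<times> ('b, 'b) cochain \<times> ('a, 'b) cochain"

definition mor_cochains ::
  "nat \<Rightarrow> ('k::comm_ring_1, 'a::ab_group_add) hom_alg \<Rightarrow> ('k, 'b::ab_group_add) hom_alg \<Rightarrow>
   ('a, 'b) mor_cochain set" where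
  "mor_cochains n A B = cochains n A A \<times> cochains n B B \<times> cochains (n - 1) A B"

definition mor_delta ::
  "('k::comm_ring_1, 'a::ab_group_add) hom_alg \<Rightarrow> ('k, 'b::ab_group_add) hom_alg \<Rightarrow>
   ('a \<Rightarrow> 'b) \<Rightarrow> nat \<Rightarrow> ('a, 'b) mor_cochain \<Rightarrow> ('a, 'b) mor_cochain" where
  "mor_delta A B \<phi> n = (\<lambda>(f1, f2, f3).
     (hom_delta A A id n f1, hom_delta B B id n f2,
      \<lambda>xs. \<phi> (f1 xs) - f2 (map \<phi> xs) - hom_delta A B \<phi> (n - 1) f3 xs))"

definition zero_mor_cochain ::
  "nat \<Rightarrow> ('a::ab_group_add, 'b::ab_group_add) mor_cochain \<Rightarrow> bool" where
  "zero_mor_cochain n = (\<lambda>(f1, f2, f3).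
     zero_cochain n f1 \<and> zero_cochain n f2 \<and> zero_cochain (n - 1) f3)"

definition mor_cocycles ::
  "nat \<Rightarrow> ('k::comm_ring_1, 'a::ab_group_add) hom_alg \<Rightarrow> ('k, 'b::ab_group_add) hom_alg \<Rightarrow>
   ('a \<Rightarrow> 'b) \<Rightarrow> ('a, 'b) mor_cochain set" where
  "mor_cocycles n A B \<phi> =
     {\<theta> \<in> mor_cochains n A B. zero_mor_cochain (n + 1) (mor_delta A B \<phi> n \<theta>)}"

text \<open>Pitfall: \<^const>\<open>deformation\<close> asks the deformed algebra to be Hom-associative, not
  multiplicative, whereas a cochain has to commute with the twists. So the infinitesimal lies in
  \<^const>\<open>mor_cochains\<close> only for deformations within the multiplicative algebras: on
  \<open>\<A> = \<K>\<close> with \<open>\<mu> = 0\<close> and \<open>\<alpha> x = 2 x\<close>, the deformation \<open>\<mu>\<^sub>t(x, y) = x y t\<close> is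
  Hom-associative, but \<open>\<alpha> (\<mu>\<^sub>1(x, y)) = 2 x y\<close> and \<open>\<mu>\<^sub>1(\<alpha> x, \<alpha> y) = 4 x y\<close>.\<close>

definition infinitesimal ::
  "(nat \<Rightarrow> 'a \<Rightarrow> 'a \<Rightarrow> 'a) \<Rightarrow> (nat \<Rightarrow> 'b \<Rightarrow> 'b \<Rightarrow> 'b) \<Rightarrow> (nat \<Rightarrow> 'a \<Rightarrow> 'b) \<Rightarrow>
   ('a, 'b) mor_cochain" where
  "infinitesimal mA mB p =
     (\<lambda>xs. mA 1 (xs ! 0) (xs ! 1), \<lambda>xs. mB 1 (xs ! 0) (xs ! 1), \<lambda>xs. p 1 (xs ! 0))"

end

theory Submission
  imports Defs
begin

text \<open>Each defining identity of the deformation, evaluated at constant power series, is compared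
  in degree \<open>1\<close>. Hom-associativity of \<open>\<mu>\<^sub>t\<close> then reads \<open>\<delta>\<^sup>2 \<mu>\<^sub>1 = 0\<close>, multiplicativity of \<open>\<phi>\<^sub>t\<close>
  reads \<open>\<phi> \<circ> \<mu>\<^sub>A\<^sub>,\<^sub>1 - \<mu>\<^sub>B\<^sub>,\<^sub>1 \<circ> \<phi>\<^sup>\<otimes>\<^sup>2 = \<delta>\<^sup>1 \<phi>\<^sub>1\<close>, and compatibility with the twists gives the cochain
  conditions.\<close>

lemma bilinear_op_zero:
  assumes "bilinear_op s m"
  shows "m x 0 = 0" "m 0 y = 0"
  using assms module_hom.zero unfolding bilinear_op_def by blast+

lemma fps_bilin_nth_0: "fps_nth (fps_bilin m x y) 0 = m 0 (fps_nth x 0) (fps_nth y 0)"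
  by (simp add: fps_bilin_def)

text \<open>The single power of t comes from the second argument, from the first, or from the
  operation.\<close>

lemma fps_bilin_nth_1:
  "fps_nth (fps_bilin m x y) 1 =
     m 0 (fps_nth x 0) (fps_nth y 1) + m 0 (fps_nth x 1) (fps_nth y 0) +
     m 1 (fps_nth x 0) (fps_nth y 0)"
  by (simp add: fps_bilin_def atMost_Suc add.commute add.left_commute)

lemma fps_lin_nth_0: "fps_nth (fps_lin f x) 0 = f 0 (fps_nth x 0)"
  by (simp add: fps_lin_def)

lemma fps_lin_nth_1: "fps_nth (fps_lin f x) 1 = f 0 (fps_nth x 1) + f 1 (fps_nth x 0)"
  by (simp add: fps_lin_def atMost_Suc add.commute)

lemmas low_coeffs = fps_bilin_nth_0 fps_bilin_nth_1 fps_lin_nth_0 fps_lin_nth_1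

lemma series_alg_simps [simp]:
  "mul (series_alg A m) = fps_bilin m"
  "fps_nth (twist (series_alg A m) x) n = twist A (fps_nth x n)"
  by (simp_all add: series_alg_def)

text \<open>On constant series the factor t can only come from one of the two products, the outer or
  the inner one. This gives the two terms on each side.\<close>

lemma deformation_hom_assoc_degree_1:
  assumes "hom_assoc_alg A" "deformation A m"
  shows "mul A (twist A x) (m 1 y z) + m 1 (twist A x) (mul A y z) =
         mul A (m 1 x y) (twist A z) + m 1 (mul A x y) (twist A z)"
proof -
  have bil: "bilinear_op (scl A) (m n)" and m0: "m 0 = mul A"
    and hom: "mul (series_alg A m) (twist (series_alg A m) u) (mul (series_alg A m) v w) =
      mul (series_alg A m) (mul (series_alg A m) u v) (twist (series_alg A m) w)" for n u v w
    using assms(2) unfolding deformation_def hom_assoc_alg_def by blast+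
  have "module_hom (scl A) (scl A) (twist A)"
    using assms(1) by (simp add: hom_assoc_alg_def)
  then have "twist A 0 = 0"
    by (rule module_hom.zero)
  then show ?thesis
    \<comment> \<open>A twisted constant series has degree 1 coefficient \<open>twist A 0\<close>,
      so \<open>twist A 0 = 0\<close> and bilinearity remove all terms that use a degree 1
      coefficient of an argument.\<close>
    using arg_cong[OF hom[of "fps_const x" "fps_const y" "fps_const z"], of "\<lambda>f. fps_nth f 1"]
      bilinear_op_zero[OF bil]
    by (simp add: low_coeffs m0[symmetric] del: One_nat_def)
qed

lemma deformation_multiplicative_degree_1:
  assumes "hom_assoc_alg A" "deformation A m" "multiplicative (series_alg A m)"
  shows "twist A (m 1 x y) = m 1 (twist A x) (twist A y)"
proof -
  have bil: "bilinear_op (scl A) (m n)" for n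
    using assms(2) unfolding deformation_def by blast
  have mult: "twist (series_alg A m) (mul (series_alg A m) u v) =
      mul (series_alg A m) (twist (series_alg A m) u) (twist (series_alg A m) v)" for u v
    using assms(3) unfolding multiplicative_def by blast
  have "module_hom (scl A) (scl A) (twist A)"
    using assms(1) by (simp add: hom_assoc_alg_def)
  then have "twist A 0 = 0"
    by (rule module_hom.zero)
  then show ?thesis
    using arg_cong[OF mult[of "fps_const x" "fps_const y"], of "\<lambda>f. fps_nth f 1"]
      bilinear_op_zero[OF bil]
    by (simp add: low_coeffs del: One_nat_def)
qed

text \<open>Applied to a constant \<open>x\<close>, \<open>fps_lin p\<close> yields a series that
  starts with \<open>\<phi> x + p 1 x t\<close>. It need not be constant, so all three terms of
  \<open>fps_bilin_nth_1\<close> survive on the left.\<close>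

lemma morphism_deformation_mul_degree_1:
  assumes "morphism_deformation A B \<phi> mA mB p"
  shows "mul B (\<phi> x) (p 1 y) + mul B (p 1 x) (\<phi> y) + mB 1 (\<phi> x) (\<phi> y) =
         \<phi> (mA 1 x y) + p 1 (mul A x y)"
proof -
  have bil: "bilinear_op (scl A) (mA n)" and m0: "mA 0 = mul A" "mB 0 = mul B" and p0: "p 0 = \<phi>"
    and lin: "module_hom (scl A) (scl B) (p n)"
    and hom: "mul (series_alg B mB) (fps_lin p u) (fps_lin p v) =
      fps_lin p (mul (series_alg A mA) u v)" for n u v
    using assms unfolding morphism_deformation_def deformation_def hom_alg_morphism_def by blast+
  show ?thesis
    using arg_cong[OF hom[of "fps_const x" "fps_const y"], of "\<lambda>f. fps_nth f 1"]
      bilinear_op_zero[OF bil] module_hom.zero[OF lin]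
    by (simp add: low_coeffs m0[symmetric] p0[symmetric] del: One_nat_def)
qed

text \<open>Commuting with the twists is part of being a morphism of the deformed algebras, so the
  cochain condition on \<open>p 1\<close> holds for every deformation of
  \<open>\<phi>\<close>.\<close>

lemma morphism_deformation_twist_degree_1:
  assumes "hom_assoc_alg A" "morphism_deformation A B \<phi> mA mB p"
  shows "twist B (p 1 x) = p 1 (twist A x)"
proof -
  have lin: "module_hom (scl A) (scl B) (p n)"
    and hom: "fps_lin p (twist (series_alg A mA) u) = twist (series_alg B mB) (fps_lin p u)" for n u
    using assms(2) unfolding morphism_deformation_def hom_alg_morphism_def by blast+
  have "module_hom (scl A) (scl A) (twist A)"
    using assms(1) by (simp add: hom_assoc_alg_def)
  then have "twist A 0 = 0"
    by (rule module_hom.zero)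
  then show ?thesis
    using arg_cong[OF hom[of "fps_const x"], of "\<lambda>f. fps_nth f 1"] module_hom.zero[OF lin]
    by (simp add: low_coeffs del: One_nat_def)
qed

lemma length_eq_2_conv: "length xs = 2 \<longleftrightarrow> (\<exists>x y. xs = [x, y])"
  by (auto simp: numeral_2_eq_2 length_Suc_conv)

lemma length_eq_3_conv: "length xs = 3 \<longleftrightarrow> (\<exists>x y z. xs = [x, y, z])"
  by (auto simp: numeral_3_eq_3 length_Suc_conv)

lemma hom_delta_1:
  assumes "module (scl B)"
  shows "hom_delta A B \<phi> 1 f [x, y] =
    mul B (\<phi> x) (f [y]) - f [mul A x y] + mul B (f [x]) (\<phi> y)"
  using assms by (simp add: hom_delta_def module.scale_minus_left module.scale_one)

text \<open>The exponent \<open>n - 1\<close> is 1 here, so the outer arguments carry the single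
  twist of Hom-associativity; for \<open>n = 1\<close> they carry none.\<close>

lemma hom_delta_2:
  assumes "module (scl B)"
  shows "hom_delta A B \<phi> 2 f [x, y, z] =
    mul B (\<phi> (twist A x)) (f [y, z]) - f [mul A x y, twist A z] + f [twist A x, mul A y z] -
    mul B (f [x, y]) (\<phi> (twist A z))"
  using assms
  by (simp add: hom_delta_def numeral_2_eq_2 module.scale_minus_left module.scale_one)

lemma deformation_zero_cochain:
  assumes "hom_assoc_alg A" "deformation A m"
  shows "zero_cochain 3 (hom_delta A A id 2 (\<lambda>xs. m 1 (xs ! 0) (xs ! 1)))"
proof -
  have "module (scl A)"
    using assms(1) by (simp add: hom_assoc_alg_def)
  then show ?thesis
    \<comment> \<open>The differential is the left side of this identity minus its right
      side.\<close>
    using deformation_hom_assoc_degree_1[OF assms]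
    by (auto simp: zero_cochain_def length_eq_3_conv hom_delta_2 algebra_simps simp del: One_nat_def)
qed

lemma deformation_cochain:
  assumes "hom_assoc_alg A" "deformation A m" "multiplicative (series_alg A m)"
  shows "(\<lambda>xs. m 1 (xs ! 0) (xs ! 1)) \<in> cochains 2 A A"
proof -
  have "bilinear_op (scl A) (m 1)"
    using assms(2) unfolding deformation_def by blast
  then show ?thesis
    using deformation_multiplicative_degree_1[OF assms]
    by (auto simp: cochains_def length_eq_2_conv bilinear_op_def less_2_cases_iff)
qed

lemma morphism_deformation_cochain:
  assumes "hom_assoc_alg A" "morphism_deformation A B \<phi> mA mB p"
  shows "(\<lambda>xs. p 1 (xs ! 0)) \<in> cochains 1 A B"
proof -
  have "module_hom (scl A) (scl B) (p 1)"
    using assms(2) unfolding morphism_deformation_def by blast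
  then show ?thesis
    using morphism_deformation_twist_degree_1[OF assms]
    by (auto simp: cochains_def length_Suc_conv)
qed

text \<open>The differential vanishes for every deformation. Membership in
  \<open>mor_cochains\<close> also asks \<open>\<mu>A 1\<close> and \<open>\<mu>B 1\<close> to
  commute with the twists, which follows once the deformed algebras are multiplicative.\<close>

theorem proposition4p3:
  fixes A :: "('k::{alg_closed_field, field_char_0}, 'a::ab_group_add) hom_alg"
    and B :: "('k, 'b::ab_group_add) hom_alg"
    and \<phi> :: "'a \<Rightarrow> 'b"
    and \<mu>A :: "nat \<Rightarrow> 'a \<Rightarrow> 'a \<Rightarrow> 'a"
    and \<mu>B :: "nat \<Rightarrow> 'b \<Rightarrow> 'b \<Rightarrow> 'b"
    and \<phi>t :: "nat \<Rightarrow> 'a \<Rightarrow> 'b"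
  assumes "hom_assoc_alg A" and "multiplicative A"
    and "hom_assoc_alg B" and "multiplicative B"
    and "hom_alg_morphism A B \<phi>"
    and "morphism_deformation A B \<phi> \<mu>A \<mu>B \<phi>t"
  shows "zero_mor_cochain 3 (mor_delta A B \<phi> 2 (infinitesimal \<mu>A \<mu>B \<phi>t)) \<and>
    (multiplicative (series_alg A \<mu>A) \<and> multiplicative (series_alg B \<mu>B) \<longrightarrow>
      infinitesimal \<mu>A \<mu>B \<phi>t \<in> mor_cocycles 2 A B \<phi>)"
proof -
  have defA: "deformation A \<mu>A" and defB: "deformation B \<mu>B"
    using assms(6) unfolding morphism_deformation_def by blast+
  have modB: "module (scl B)"
    using assms(3) by (simp add: hom_assoc_alg_def)
  have "\<phi> (\<mu>A 1 x y) - \<mu>B 1 (\<phi> x) (\<phi> y) - hom_delta A B \<phi> 1 (\<lambda>xs. \<phi>t 1 (xs ! 0)) [x, y] = 0" for x y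
    using morphism_deformation_mul_degree_1[OF assms(6), of x y]
    by (simp add: hom_delta_1[OF modB] algebra_simps del: One_nat_def)
  \<comment> \<open>The third component of a morphism 3-cochain has only 2 arguments.
    \<open>map \<phi> xs ! 0\<close> is the form in which \<open>mor_delta\<close> produces
    \<open>\<phi> (xs ! 0)\<close>.\<close>
  then have "zero_cochain 2 (\<lambda>xs. \<phi> (\<mu>A 1 (xs ! 0) (xs ! 1)) - \<mu>B 1 (map \<phi> xs ! 0) (map \<phi> xs ! 1)
      - hom_delta A B \<phi> 1 (\<lambda>xs. \<phi>t 1 (xs ! 0)) xs)"
    by (auto simp: zero_cochain_def length_eq_2_conv)
  then have zero: "zero_mor_cochain 3 (mor_delta A B \<phi> 2 (infinitesimal \<mu>A \<mu>B \<phi>t))"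
    using deformation_zero_cochain[OF assms(1) defA] deformation_zero_cochain[OF assms(3) defB]
    by (simp add: zero_mor_cochain_def mor_delta_def infinitesimal_def)
  moreover have "infinitesimal \<mu>A \<mu>B \<phi>t \<in> mor_cochains 2 A B"
    if "multiplicative (series_alg A \<mu>A)" "multiplicative (series_alg B \<mu>B)"
    using deformation_cochain[OF assms(1) defA that(1)] deformation_cochain[OF assms(3) defB that(2)]
      morphism_deformation_cochain[OF assms(1,6)]
    by (simp add: mor_cochains_def infinitesimal_def)
  ultimately show ?thesis
    by (simp add: mor_cocycles_def)
qed

end
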